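(* Let $G=(V,E)$ be a graph. For every $i\in\{0,\dots,|E|\}$, the number $d(G,i)$ of vertices of degree $i$ in $G$ is encoded in the trivariate chromatic polynomial $\tilde P(G,x,y,z)$: it is the coefficient of the monomial $v^1z^{|E|-i}$ in the polynomial $\tilde P(G,v+1,1,z)$ in the variables $v,z$, i.e. $$d(G,i)=[v^1z^{|E|-i}]\bigl(\tilde P(G,v+1,1,z)\bigr),$$ where $|E|$ equals the degree of $\tilde P(G,v+1,1,z)$ in the variable $z$.
   Context: Graphs are finite. A graph $G=(V,E)$ consists of a vertex set $V$ and a multiset $E$ of edges, each edge being a one- or two-element subset of $V$ (loops and parallel edges allowed). The degree of a vertex $w$ is the number of edges $e\in E$ (counted with multiplicity) with $w\in e$; in particular a loop contributes $1$. Trivariate chromatic polynomial: for nonnegative integers $y\le x$, $$\tilde P(G,x,y,z)=\sum_{\phi\colon V\to\{1,\dots,x\}} z^{\,|\{e\in E\,:\,\exists c\le y\ \forall w\in e\colon \phi(w)=c\}|},$$ where edges are counted with multiplicity. These values are given by a unique polynomial in $x,y,z$, and $\tilde P(G,x,y,z)$ denotes this polynomial. $[m](P)$ denotes the coefficient of the monomial $m$ in the polynomial $P$. *)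

theory Defs
  imports
    "HOL-Library.Multiset"
    "HOL-Library.FuncSet"
    "HOL-Computational_Algebra.Polynomial"
begin

definition multigraph :: "'a set \<Rightarrow> 'a set multiset \<Rightarrow> bool" where
  "multigraph V E \<longleftrightarrow> finite V \<and> (\<forall>e\<in>#E. e \<subseteq> V \<and> (card e = 1 \<or> card e = 2))"

text \<open>A loop is a one-element edge, so it contributes 1 (not 2) to the degree of its vertex.\<close>

definition vertex_degree :: "'a set multiset \<Rightarrow> 'a \<Rightarrow> nat" where
  "vertex_degree E w = size {#e \<in># E. w \<in> e#}"

definition num_vertices_of_degree :: "'a set \<Rightarrow> 'a set multiset \<Rightarrow> nat \<Rightarrow> nat" where
  "num_vertices_of_degree V E i = card {w \<in> V. vertex_degree E w = i}"

definition num_mono_edges :: "'a set multiset \<Rightarrow> nat \<Rightarrow> ('a \<Rightarrow> nat) \<Rightarrow> nat" where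
  "num_mono_edges E y \<phi> = size {#e \<in># E. \<exists>c\<le>y. \<forall>w\<in>e. \<phi> w = c#}"

text \<open>The value at natural numbers \<open>x\<close>, \<open>y\<close>, as a polynomial in the indeterminate \<open>z\<close>.\<close>

definition trichrom_value :: "'a set \<Rightarrow> 'a set multiset \<Rightarrow> nat \<Rightarrow> nat \<Rightarrow> int poly" where
  "trichrom_value V E x y = (\<Sum>\<phi> \<in> V \<rightarrow>\<^sub>E {1..x}. monom 1 (num_mono_edges E y \<phi>))"

text \<open>
  The trivariate polynomial is an element of \<open>\<int>[z][x][y]\<close>: the outermost variable is \<open>y\<close>,
  the middle one is \<open>x\<close> and the innermost one is \<open>z\<close>.
\<close>

definition trichrom_poly :: "'a set \<Rightarrow> 'a set multiset \<Rightarrow> int poly poly poly" where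
  "trichrom_poly V E =
    (THE P. \<forall>x y. y \<le> x \<longrightarrow> poly (poly P (of_nat y)) (of_nat x) = trichrom_value V E x y)"

text \<open>
  Substituting \<open>y = 1\<close> and \<open>x = v + 1\<close> gives an element of \<open>\<int>[z][v]\<close>, with \<open>v\<close> the outer
  variable; the coefficient of \<open>v\<^sup>k z\<^sup>j\<close> in it is \<open>coeff (coeff Q k) j\<close>.
\<close>

definition trichrom_v1 :: "'a set \<Rightarrow> 'a set multiset \<Rightarrow> int poly poly" where
  "trichrom_v1 V E = pcompose (poly (trichrom_poly V E) 1) [:1, 1:]"

text \<open>Degree in the inner variable; the range is finite because almost all coefficients are 0.\<close>

definition inner_degree :: "'a::zero poly poly \<Rightarrow> nat" where
  "inner_degree Q = Max (range (\<lambda>k. degree (coeff Q k)))"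

end

theory Submission imports Defs begin

text \<open>
  Call a vertex \<^emph>\<open>low\<close> under a colouring if its colour is at most \<open>y\<close>.  Only edges whose ends
  are all low can contribute a factor \<open>z\<close>, and the vertices that are not low choose freely among
  \<open>x - y\<close> colours.  Sorting the colourings by their set \<open>W\<close> of low vertices gives
  (\<open>trichrom_value_by_low_vertices\<close>)
  \<open>P(x,y,z) = (\<Sum>W\<subseteq>V. (x - y)^|V - W| * S\<^sub>W(y,z))\<close>,
  where \<open>S\<^sub>W(y,z)\<close> sums \<open>z\<close> raised to the number of monochromatic edges over all \<open>y\<close>-colourings of the
  subgraph induced by \<open>W\<close>.

  For \<open>y = 1\<close> there is a single colouring of \<open>W\<close>, and every edge inside \<open>W\<close> is monochromatic.
  With \<open>x = v + 1\<close> the sum becomes \<open>(\<Sum>W\<subseteq>V. v^|V - W| * z^|E(G[W])|)\<close> (\<open>trichrom_v1_eq\<close>).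
  Its terms linear in \<open>v\<close> come from \<open>W = V - {w}\<close>, and deleting \<open>w\<close> destroys exactly \<open>deg w\<close> edges;
  so \<open>v z^(|E| - i)\<close> counts the vertices of degree \<open>i\<close>.  The term for \<open>W = V\<close> is \<open>z^|E|\<close>, and
  no other term has a larger exponent of \<open>z\<close>.

  All this speaks about values, so it remains to see that there is exactly one polynomial
  with these values.  Uniqueness holds because each variable may take infinitely many values.
  Existence over the integers reduces to \<open>S\<^sub>W\<close>, whose summand depends only on which vertices
  share a colour; \<open>kernel_invariant_sum_polynomial\<close> shows, colouring one vertex after the other,
  that such sums are polynomial in the number of colours, without introducing denominators.
\<close>

section \<open>Sums over colourings that depend only on the colour classes\<close>

text \<open>
  Such an \<open>F\<close> sees only the partition of \<open>W\<close> into colour classes: neither the names of the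
  colours nor the values outside \<open>W\<close> matter.
\<close>

definition kernel_invariant :: "'a set \<Rightarrow> (('a \<Rightarrow> nat) \<Rightarrow> 'r) \<Rightarrow> bool" where
  "kernel_invariant W F \<longleftrightarrow>
     (\<forall>\<phi> \<psi>. (\<forall>u\<in>W. \<forall>v\<in>W. \<phi> u = \<phi> v \<longleftrightarrow> \<psi> u = \<psi> v) \<longrightarrow> F \<phi> = F \<psi>)"

lemma kernel_invariantD:
  assumes "kernel_invariant W F" "\<And>u v. u \<in> W \<Longrightarrow> v \<in> W \<Longrightarrow> \<phi> u = \<phi> v \<longleftrightarrow> \<psi> u = \<psi> v"
  shows "F \<phi> = F \<psi>"
  using assms unfolding kernel_invariant_def by blast

text \<open>
  Colourings with the same kernel use corresponding colours, so a sum over the used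
  colours again depends on the kernel alone.
\<close>

lemma kernel_invariant_sum_over_image:
  assumes "\<And>\<phi> \<psi> u. u \<in> W \<Longrightarrow> (\<And>s t. s \<in> W \<Longrightarrow> t \<in> W \<Longrightarrow> \<phi> s = \<phi> t \<longleftrightarrow> \<psi> s = \<psi> t)
             \<Longrightarrow> H \<phi> (\<phi> u) = H \<psi> (\<psi> u)"
  shows "kernel_invariant W (\<lambda>\<phi>. \<Sum>c\<in>\<phi> ` W. H \<phi> c)"
  unfolding kernel_invariant_def
proof (intro allI impI)
  fix \<phi> \<psi> :: "'a \<Rightarrow> nat"
  assume ker: "\<forall>u\<in>W. \<forall>v\<in>W. \<phi> u = \<phi> v \<longleftrightarrow> \<psi> u = \<psi> v"
  have match: "\<phi> (inv_into W \<psi> (\<psi> u)) = \<phi> u" "\<psi> (inv_into W \<phi> (\<phi> u)) = \<psi> u" if "u \<in> W" for u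
  proof -
    have "inv_into W \<psi> (\<psi> u) \<in> W" "inv_into W \<phi> (\<phi> u) \<in> W"
      "\<psi> (inv_into W \<psi> (\<psi> u)) = \<psi> u" "\<phi> (inv_into W \<phi> (\<phi> u)) = \<phi> u"
      using that by (auto intro: inv_into_into f_inv_into_f)
    with ker that show "\<phi> (inv_into W \<psi> (\<psi> u)) = \<phi> u" "\<psi> (inv_into W \<phi> (\<phi> u)) = \<psi> u"
      by blast+
  qed
  \<comment> \<open>A colour of \<open>\<phi>\<close> corresponds to the colour that \<open>\<psi>\<close> gives to any vertex of that class.\<close>
  show "(\<Sum>c\<in>\<phi> ` W. H \<phi> c) = (\<Sum>c\<in>\<psi> ` W. H \<psi> c)"
  proof (rule sum.reindex_bij_witness
      [where i = "\<lambda>d. \<phi> (inv_into W \<psi> d)" and j = "\<lambda>c. \<psi> (inv_into W \<phi> c)"])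
    fix c assume "c \<in> \<phi> ` W"
    then obtain u where u: "u \<in> W" "c = \<phi> u" by blast
    show "\<phi> (inv_into W \<psi> (\<psi> (inv_into W \<phi> c))) = c" "\<psi> (inv_into W \<phi> c) \<in> \<psi> ` W"
      using u match by auto
    have "H \<phi> (\<phi> u) = H \<psi> (\<psi> u)" using ker u by (intro assms) auto
    then show "H \<psi> (\<psi> (inv_into W \<phi> c)) = H \<phi> c" using u match by simp
  next
    fix d assume "d \<in> \<psi> ` W"
    then obtain u where u: "u \<in> W" "d = \<psi> u" by blast
    show "\<psi> (inv_into W \<phi> (\<phi> (inv_into W \<psi> d))) = d" "\<phi> (inv_into W \<psi> d) \<in> \<phi> ` W"
      using u match by auto
  qed
qed

lemma sum_PiE_insert:
  assumes "w \<notin> W"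
  shows "(\<Sum>\<phi>\<in>insert w W \<rightarrow>\<^sub>E C. F \<phi>) = (\<Sum>\<phi>\<in>W \<rightarrow>\<^sub>E C. \<Sum>c\<in>C. F (\<phi>(w := c)))"
proof -
  have "(\<Sum>\<phi>\<in>insert w W \<rightarrow>\<^sub>E C. F \<phi>) = (\<Sum>(c, \<phi>)\<in>C \<times> (W \<rightarrow>\<^sub>E C). F (\<phi>(w := c)))"
    unfolding PiE_insert_eq
    by (subst sum.reindex[OF inj_combinator[OF assms]]) (simp add: case_prod_unfold)
  also have "\<dots> = (\<Sum>c\<in>C. \<Sum>\<phi>\<in>W \<rightarrow>\<^sub>E C. F (\<phi>(w := c)))"
    by (simp add: sum.cartesian_product)
  finally show ?thesis by (simp add: sum.swap[of _ C])
qed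

text \<open>
  The new vertex \<open>w\<close> either repeats a colour of \<open>W\<close> or takes one of the \<open>y - |\<phi> ` W|\<close> fresh
  ones, and all fresh ones give the same summand \<open>N \<phi>\<close>.  Charging \<open>N \<phi>\<close> for all \<open>y\<close> colours and
  correcting at the repeated ones leaves two kernel invariant sums over \<open>W\<close>, the first of them
  multiplied by \<open>y\<close>.
\<close>

lemma kernel_invariant_sum_polynomial:
  fixes F :: "('a \<Rightarrow> nat) \<Rightarrow> 'r::comm_ring_1"
  assumes "finite W" "kernel_invariant W F"
  shows "\<exists>p. \<forall>y. poly p (of_nat y) = (\<Sum>\<phi>\<in>W \<rightarrow>\<^sub>E {1..y}. F \<phi>)"
  using assms
proof (induction W arbitrary: F)
  case empty
  show ?case by (rule exI[of _ "[:F (\<lambda>_. undefined):]"]) simp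
next
  case (insert w W)
  define N where "N \<phi> = F (\<phi>(w := (SOME c. c \<notin> \<phi> ` W)))" for \<phi>
  define D where "D \<phi> = (\<Sum>c\<in>\<phi> ` W. F (\<phi>(w := c)) - N \<phi>)" for \<phi>
  have fresh: "(SOME c. c \<notin> \<phi> ` W) \<notin> \<phi> ` W" for \<phi> :: "'a \<Rightarrow> nat"
    using someI_ex[OF ex_new_if_finite[OF infinite_UNIV_nat finite_imageI[OF insert.hyps(1)]]] .
  have N_eq: "F (\<phi>(w := c)) = N \<phi>" if "c \<notin> \<phi> ` W" for \<phi> c
    unfolding N_def using that fresh[of \<phi>] insert.hyps(2)
    by (intro kernel_invariantD[OF insert.prems]) (auto simp: image_iff)
  have N_cong: "N \<phi> = N \<psi>"
    if "\<And>s t. s \<in> W \<Longrightarrow> t \<in> W \<Longrightarrow> \<phi> s = \<phi> t \<longleftrightarrow> \<psi> s = \<psi> t" for \<phi> \<psi>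
    unfolding N_def using that fresh[of \<phi>] fresh[of \<psi>] insert.hyps(2)
    by (intro kernel_invariantD[OF insert.prems]) (auto simp: image_iff)
  have "kernel_invariant W N"
    unfolding kernel_invariant_def using N_cong by blast
  then obtain p where p: "\<And>y. poly p (of_nat y) = (\<Sum>\<phi>\<in>W \<rightarrow>\<^sub>E {1..y}. N \<phi>)"
    using insert.IH by blast
  have "kernel_invariant W D"
    unfolding D_def
  proof (rule kernel_invariant_sum_over_image)
    fix \<phi> \<psi> :: "'a \<Rightarrow> nat" and u
    assume u: "u \<in> W" and ker: "\<And>s t. s \<in> W \<Longrightarrow> t \<in> W \<Longrightarrow> \<phi> s = \<phi> t \<longleftrightarrow> \<psi> s = \<psi> t"
    have "F (\<phi>(w := \<phi> u)) = F (\<psi>(w := \<psi> u))"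
      using u ker insert.hyps(2) by (intro kernel_invariantD[OF insert.prems]) auto
    then show "F (\<phi>(w := \<phi> u)) - N \<phi> = F (\<psi>(w := \<psi> u)) - N \<psi>"
      using N_cong[OF ker] by simp
  qed
  then obtain q where q: "\<And>y. poly q (of_nat y) = (\<Sum>\<phi>\<in>W \<rightarrow>\<^sub>E {1..y}. D \<phi>)"
    using insert.IH by blast
  have "(\<Sum>\<phi>\<in>insert w W \<rightarrow>\<^sub>E {1..y}. F \<phi>) = poly (pCons 0 p + q) (of_nat y)" for y
  proof -
    have "(\<Sum>c\<in>{1..y}. F (\<phi>(w := c))) = of_nat y * N \<phi> + D \<phi>" if "\<phi> \<in> W \<rightarrow>\<^sub>E {1..y}" for \<phi>
    proof -
      have sub: "\<phi> ` W \<subseteq> {1..y}" using that by auto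
      have "(\<Sum>c\<in>{1..y}. F (\<phi>(w := c)) - N \<phi>) = D \<phi>"
        unfolding D_def using sub N_eq by (intro sum.mono_neutral_right) auto
      then show ?thesis by (simp add: sum_subtractf algebra_simps)
    qed
    then show ?thesis
      by (simp add: sum_PiE_insert[OF insert.hyps(2)] p q sum.distrib sum_distrib_left)
  qed
  then show ?case by metis
qed

section \<open>Sorting colourings by their low vertices\<close>

definition induced_mono_edges :: "'a set multiset \<Rightarrow> 'a set \<Rightarrow> ('a \<Rightarrow> nat) \<Rightarrow> nat" where
  "induced_mono_edges E W \<phi> = size {#e \<in># E. e \<subseteq> W \<and> (\<forall>u\<in>e. \<forall>v\<in>e. \<phi> u = \<phi> v)#}"

lemma kernel_invariant_induced_mono_edges:
  "kernel_invariant W (\<lambda>\<phi>. f (induced_mono_edges E W \<phi>))"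
  unfolding kernel_invariant_def induced_mono_edges_def
proof (intro allI impI)
  fix \<phi> \<psi> :: "'a \<Rightarrow> nat"
  assume ker: "\<forall>u\<in>W. \<forall>v\<in>W. \<phi> u = \<phi> v \<longleftrightarrow> \<psi> u = \<psi> v"
  have "e \<subseteq> W \<and> (\<forall>u\<in>e. \<forall>v\<in>e. \<phi> u = \<phi> v) \<longleftrightarrow> e \<subseteq> W \<and> (\<forall>u\<in>e. \<forall>v\<in>e. \<psi> u = \<psi> v)" for e
    using ker by blast
  then show "f (size {#e \<in># E. e \<subseteq> W \<and> (\<forall>u\<in>e. \<forall>v\<in>e. \<phi> u = \<phi> v)#})
           = f (size {#e \<in># E. e \<subseteq> W \<and> (\<forall>u\<in>e. \<forall>v\<in>e. \<psi> u = \<psi> v)#})"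
    by simp
qed

lemma num_mono_edges_eq_induced:
  assumes "multigraph V E" "{w \<in> V. \<phi> w \<le> y} = W"
  shows "num_mono_edges E y \<phi> = induced_mono_edges E W \<phi>"
  unfolding num_mono_edges_def induced_mono_edges_def
proof (intro arg_cong[of _ _ size] filter_mset_cong refl)
  fix e assume "e \<in># E"
  with assms(1) have e: "e \<subseteq> V" "e \<noteq> {}" unfolding multigraph_def by auto
  then obtain u where u: "u \<in> e" by blast
  have "e \<subseteq> W \<longleftrightarrow> (\<forall>w\<in>e. \<phi> w \<le> y)" using assms(2) e(1) by blast
  with u show "(\<exists>c\<le>y. \<forall>w\<in>e. \<phi> w = c) \<longleftrightarrow> (e \<subseteq> W \<and> (\<forall>u\<in>e. \<forall>v\<in>e. \<phi> u = \<phi> v))"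
    by metis
qed

lemma induced_mono_edges_cong:
  "(\<And>w. w \<in> W \<Longrightarrow> \<phi> w = \<psi> w) \<Longrightarrow> induced_mono_edges E W \<phi> = induced_mono_edges E W \<psi>"
  using kernel_invariant_induced_mono_edges[of W "\<lambda>n. n" E]
  unfolding kernel_invariant_def by simp

text \<open>
  A colouring with low set \<open>W\<close> is a pair of independent colourings: of \<open>W\<close> with
  low colours and of \<open>V - W\<close> with the others.
\<close>

lemma sum_fixed_low_vertices:
  fixes f :: "nat \<Rightarrow> 'r::comm_semiring_1"
  assumes G: "multigraph V E" and "W \<subseteq> V" "y \<le> x"
  shows "(\<Sum>\<phi> | \<phi> \<in> V \<rightarrow>\<^sub>E {1..x} \<and> {w \<in> V. \<phi> w \<le> y} = W. f (num_mono_edges E y \<phi>))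
       = of_nat (x - y) ^ card (V - W) * (\<Sum>\<phi>\<in>W \<rightarrow>\<^sub>E {1..y}. f (induced_mono_edges E W \<phi>))"
    (is "?L = _")
proof -
  have fin: "finite (V - W)" using G unfolding multigraph_def by auto
  have "?L = (\<Sum>(\<alpha>, \<beta>)\<in>(W \<rightarrow>\<^sub>E {1..y}) \<times> ((V - W) \<rightarrow>\<^sub>E {y<..x}). f (induced_mono_edges E W \<alpha>))"
    \<comment> \<open>Since \<open>\<beta>\<close> is \<open>undefined\<close> outside \<open>V - W\<close>, the glued function is \<open>undefined\<close> outside \<open>V\<close>.\<close>
  proof (rule sum.reindex_bij_witness
      [where i = "\<lambda>(\<alpha>, \<beta>) w. if w \<in> W then \<alpha> w else \<beta> w"
         and j = "\<lambda>\<phi>. (restrict \<phi> W, restrict \<phi> (V - W))"])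
    fix \<phi> assume \<phi>: "\<phi> \<in> {\<phi>. \<phi> \<in> V \<rightarrow>\<^sub>E {1..x} \<and> {w \<in> V. \<phi> w \<le> y} = W}"
    show "(case (restrict \<phi> W, restrict \<phi> (V - W)) of (\<alpha>, \<beta>) \<Rightarrow> \<lambda>w. if w \<in> W then \<alpha> w else \<beta> w) = \<phi>"
      using \<phi> by (auto simp: fun_eq_iff PiE_def extensional_def)
    show "(restrict \<phi> W, restrict \<phi> (V - W)) \<in> (W \<rightarrow>\<^sub>E {1..y}) \<times> ((V - W) \<rightarrow>\<^sub>E {y<..x})"
      using \<phi> by (auto simp: PiE_def Pi_def)
    show "(case (restrict \<phi> W, restrict \<phi> (V - W)) of (\<alpha>, \<beta>) \<Rightarrow> f (induced_mono_edges E W \<alpha>))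
          = f (num_mono_edges E y \<phi>)"
      using \<phi> num_mono_edges_eq_induced[OF G, of \<phi> y W]
        induced_mono_edges_cong[of W "restrict \<phi> W" \<phi> E] by simp
  next
    fix ab assume "ab \<in> (W \<rightarrow>\<^sub>E {1..y}) \<times> ((V - W) \<rightarrow>\<^sub>E {y<..x})"
    then obtain \<alpha> \<beta> where ab: "ab = (\<alpha>, \<beta>)" "\<alpha> \<in> W \<rightarrow>\<^sub>E {1..y}" "\<beta> \<in> (V - W) \<rightarrow>\<^sub>E {y<..x}"
      by blast
    have low: "1 \<le> \<alpha> w \<and> \<alpha> w \<le> y" if "w \<in> W" for w using ab(2) that by (auto dest: PiE_mem)
    have high: "y < \<beta> w \<and> \<beta> w \<le> x" if "w \<in> V - W" for w using PiE_mem[OF ab(3) that] by auto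
    show "(case ab of (\<alpha>, \<beta>) \<Rightarrow> \<lambda>w. if w \<in> W then \<alpha> w else \<beta> w)
            \<in> {\<phi>. \<phi> \<in> V \<rightarrow>\<^sub>E {1..x} \<and> {w \<in> V. \<phi> w \<le> y} = W}"
    proof -
      have "(\<lambda>w. if w \<in> W then \<alpha> w else \<beta> w) \<in> V \<rightarrow>\<^sub>E {1..x}"
      proof (rule PiE_I)
        fix w assume "w \<in> V"
        then show "(if w \<in> W then \<alpha> w else \<beta> w) \<in> {1..x}"
          using low[of w] high[of w] \<open>y \<le> x\<close> by auto
      next
        fix w assume "w \<notin> V"
        then show "(if w \<in> W then \<alpha> w else \<beta> w) = undefined"
          using \<open>W \<subseteq> V\<close> PiE_arb[OF ab(3), of w] by auto
      qed
      moreover have "{w \<in> V. (if w \<in> W then \<alpha> w else \<beta> w) \<le> y} = W"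
        using low high \<open>W \<subseteq> V\<close> by (force simp: not_le[symmetric])
      ultimately show ?thesis by (simp add: ab(1))
    qed
    show "(restrict (case ab of (\<alpha>, \<beta>) \<Rightarrow> \<lambda>w. if w \<in> W then \<alpha> w else \<beta> w) W,
           restrict (case ab of (\<alpha>, \<beta>) \<Rightarrow> \<lambda>w. if w \<in> W then \<alpha> w else \<beta> w) (V - W)) = ab"
      using PiE_arb[OF ab(2)] PiE_arb[OF ab(3)] by (auto simp: ab(1) fun_eq_iff restrict_def)
  qed
  also have "\<dots> = (\<Sum>\<alpha>\<in>W \<rightarrow>\<^sub>E {1..y}. \<Sum>\<beta>\<in>(V - W) \<rightarrow>\<^sub>E {y<..x}. f (induced_mono_edges E W \<alpha>))"
    by (rule sum.cartesian_product[symmetric])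
  also have "\<dots> = of_nat (x - y) ^ card (V - W) * (\<Sum>\<alpha>\<in>W \<rightarrow>\<^sub>E {1..y}. f (induced_mono_edges E W \<alpha>))"
    by (simp add: card_PiE[OF fin] sum_distrib_left)
  finally show ?thesis .
qed

lemma trichrom_value_by_low_vertices:
  assumes "multigraph V E" "y \<le> x"
  shows "trichrom_value V E x y = (\<Sum>W\<in>Pow V. of_nat (x - y) ^ card (V - W) *
           (\<Sum>\<phi>\<in>W \<rightarrow>\<^sub>E {1..y}. monom 1 (induced_mono_edges E W \<phi>)))"
proof -
  have fin: "finite V" using assms(1) by (simp add: multigraph_def)
  have "trichrom_value V E x y = (\<Sum>W\<in>Pow V. \<Sum>\<phi> | \<phi> \<in> V \<rightarrow>\<^sub>E {1..x} \<and> {w \<in> V. \<phi> w \<le> y} = W.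
          monom 1 (num_mono_edges E y \<phi>))"
    unfolding trichrom_value_def
    by (rule sum.group[symmetric]) (use fin in \<open>auto intro: finite_PiE\<close>)
  also have "\<dots> = (\<Sum>W\<in>Pow V. of_nat (x - y) ^ card (V - W) *
           (\<Sum>\<phi>\<in>W \<rightarrow>\<^sub>E {1..y}. monom 1 (induced_mono_edges E W \<phi>)))"
    by (intro sum.cong refl sum_fixed_low_vertices assms) auto
  finally show ?thesis .
qed

section \<open>The trivariate chromatic polynomial is well defined\<close>

lemma poly_eqI_infinite_points:
  fixes p q :: "'r::idom poly"
  assumes "infinite A" "\<And>a. a \<in> A \<Longrightarrow> poly p a = poly q a"
  shows "p = q"
proof (rule ccontr)
  assume "p \<noteq> q"
  then have "finite {a. poly (p - q) a = 0}" by (intro poly_roots_finite) simp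
  moreover have "A \<subseteq> {a. poly (p - q) a = 0}" using assms(2) by auto
  ultimately show False using assms(1) finite_subset by blast
qed

lemma infinite_of_nat_ge: "infinite ((of_nat :: nat \<Rightarrow> 'r::semiring_char_0) ` {n..})"
  by (simp add: finite_image_iff inj_on_def infinite_Ici)

lemma trichrom_poly_exists:
  assumes "multigraph V E"
  shows "\<exists>P. \<forall>x y. y \<le> x \<longrightarrow> poly (poly P (of_nat y)) (of_nat x) = trichrom_value V E x y"
proof -
  have fin: "finite V" using assms by (simp add: multigraph_def)
  \<comment> \<open>The values are embedded as constants in \<open>x\<close>, so that the polynomial in \<open>y\<close> that is
      obtained already has its coefficients in \<open>\<int>[z][x]\<close>.\<close>
  have "\<exists>p. \<forall>y. poly p (of_nat y) =
          (\<Sum>\<phi>\<in>W \<rightarrow>\<^sub>E {1..y}. [:monom 1 (induced_mono_edges E W \<phi>) :: int poly:])"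
    if "W \<in> Pow V" for W
    using that fin
    by (intro kernel_invariant_sum_polynomial
        kernel_invariant_induced_mono_edges[where f = "\<lambda>n. [:monom 1 n:]"]) (auto intro: finite_subset)
  then obtain S where S: "\<And>W y. W \<in> Pow V \<Longrightarrow> poly (S W) (of_nat y) =
          (\<Sum>\<phi>\<in>W \<rightarrow>\<^sub>E {1..y}. [:monom 1 (induced_mono_edges E W \<phi>) :: int poly:])"
    by metis
  \<comment> \<open>\<open>[:[:0, 1:], -1:]\<close> is \<open>x - y\<close>.\<close>
  define P where "P = (\<Sum>W\<in>Pow V. [:[:0, 1:], -1:] ^ card (V - W) * S W)"
  have "poly (poly P (of_nat y)) (of_nat x) = trichrom_value V E x y" if "y \<le> x" for x y
  proof -
    have "poly (poly P (of_nat y)) (of_nat x) =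
        (\<Sum>W\<in>Pow V. of_nat (x - y) ^ card (V - W) * poly (poly (S W) (of_nat y)) (of_nat x))"
      unfolding P_def using that by (simp add: poly_sum of_nat_diff)
    also have "\<dots> = trichrom_value V E x y"
      unfolding trichrom_value_by_low_vertices[OF assms that]
      by (intro sum.cong refl arg_cong2[of _ _ _ _ times]) (simp only: S, simp add: poly_sum)
    finally show ?thesis .
  qed
  then show ?thesis by blast
qed

text \<open>
  The values are prescribed only for \<open>y \<le> x\<close>, but this leaves infinitely many \<open>x\<close> for each \<open>y\<close>.
\<close>

lemma trichrom_poly_unique:
  fixes P Q :: "'r::{idom, ring_char_0} poly poly"
  assumes "\<And>x y. y \<le> x \<Longrightarrow> poly (poly P (of_nat y)) (of_nat x) = poly (poly Q (of_nat y)) (of_nat x)"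
  shows "P = Q"
proof (rule poly_eqI_infinite_points[OF infinite_of_nat_ge[of 0]])
  fix b :: "'r poly" assume "b \<in> of_nat ` {0..}"
  then obtain y where b: "b = of_nat y" by blast
  show "poly P b = poly Q b"
    unfolding b by (rule poly_eqI_infinite_points[OF infinite_of_nat_ge[of y]]) (use assms in auto)
qed

lemma poly_trichrom_poly:
  assumes "multigraph V E" "y \<le> x"
  shows "poly (poly (trichrom_poly V E) (of_nat y)) (of_nat x) = trichrom_value V E x y"
proof -
  have "\<exists>!P. \<forall>x y. y \<le> x \<longrightarrow> poly (poly P (of_nat y)) (of_nat x) = trichrom_value V E x y"
    using trichrom_poly_exists[OF assms(1)] by (auto intro!: ex_ex1I trichrom_poly_unique)
  from theI'[OF this] show ?thesis
    using assms(2) unfolding trichrom_poly_def by blast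
qed

section \<open>One low colour\<close>

lemma sum_single_colour:
  "(\<Sum>\<phi>\<in>W \<rightarrow>\<^sub>E {1..1}. f (induced_mono_edges E W \<phi>)) = f (size {#e \<in># E. e \<subseteq> W#})"
proof -
  have "W \<rightarrow>\<^sub>E {1..1::nat} = {\<lambda>w\<in>W. 1}" by (simp add: PiE_singleton restrict_def)
  moreover have "induced_mono_edges E W (\<lambda>w\<in>W. 1) = size {#e \<in># E. e \<subseteq> W#}"
    unfolding induced_mono_edges_def
    by (intro arg_cong[of _ _ size] filter_mset_cong) (auto simp: subset_iff)
  ultimately show ?thesis by simp
qed

text \<open>
  For \<open>x = v + 1\<close> and \<open>y = 1\<close> the factor \<open>x - y\<close> is \<open>v\<close>.  Both sides agree at all natural numbers
  \<open>v\<close>, where the polynomial is given by the colouring sum, and hence they are equal.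
\<close>

lemma trichrom_v1_eq:
  assumes "multigraph V E"
  shows "trichrom_v1 V E =
           (\<Sum>W\<in>Pow V. monom (monom 1 (size {#e \<in># E. e \<subseteq> W#})) (card (V - W)))"
proof (rule poly_eqI_infinite_points[OF infinite_of_nat_ge[of 0]])
  fix a :: "int poly" assume "a \<in> of_nat ` {0..}"
  then obtain v where a: "a = of_nat v" by blast
  have "poly (trichrom_v1 V E) a = poly (poly (trichrom_poly V E) (of_nat 1)) (of_nat (v + 1))"
    by (simp add: trichrom_v1_def poly_pcompose a add.commute)
  also have "\<dots> = trichrom_value V E (v + 1) 1"
    by (rule poly_trichrom_poly[OF assms]) simp
  also have "\<dots> = (\<Sum>W\<in>Pow V. of_nat v ^ card (V - W) * monom 1 (size {#e \<in># E. e \<subseteq> W#}))"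
    by (subst trichrom_value_by_low_vertices[OF assms]) (simp_all only: sum_single_colour, simp_all)
  finally show "poly (trichrom_v1 V E) a =
      poly (\<Sum>W\<in>Pow V. monom (monom 1 (size {#e \<in># E. e \<subseteq> W#})) (card (V - W))) a"
    by (simp add: poly_sum poly_monom a mult.commute)
qed

lemma coeff_trichrom_v1:
  assumes "multigraph V E"
  shows "coeff (trichrom_v1 V E) k =
           (\<Sum>W | W \<subseteq> V \<and> card (V - W) = k. monom 1 (size {#e \<in># E. e \<subseteq> W#}))"
proof -
  have "finite (Pow V)" using assms by (simp add: multigraph_def)
  then show ?thesis
    unfolding trichrom_v1_eq[OF assms] coeff_sum coeff_monom
    by (simp add: sum.If_cases Int_def Pow_def)
qed

lemma coeff_trichrom_v1_0:
  assumes "multigraph V E"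
  shows "coeff (trichrom_v1 V E) 0 = monom 1 (size E)"
proof -
  have "finite V" using assms by (simp add: multigraph_def)
  then have "{W. W \<subseteq> V \<and> card (V - W) = 0} = {V}" by auto
  moreover have "{#e \<in># E. e \<subseteq> V#} = E"
    using assms by (simp add: multigraph_def filter_mset_eq_conv)
  ultimately show ?thesis by (simp add: coeff_trichrom_v1[OF assms])
qed

text \<open>
  The induced subgraphs that miss exactly one vertex are the vertex deletions, and a deletion
  loses the edges at the deleted vertex; a loop is one such edge, in accordance with
  its contribution to the degree.
\<close>

lemma coeff_trichrom_v1_1:
  assumes "multigraph V E"
  shows "coeff (trichrom_v1 V E) 1 = (\<Sum>w\<in>V. monom 1 (size E - vertex_degree E w))"
proof -
  have sets: "{W. W \<subseteq> V \<and> card (V - W) = 1} = (\<lambda>w. V - {w}) ` V"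
  proof (intro equalityI subsetI)
    fix W assume "W \<in> {W. W \<subseteq> V \<and> card (V - W) = 1}"
    then obtain w where "W \<subseteq> V" "V - W = {w}" by (auto simp: card_1_singleton_iff)
    then have "w \<in> V" "W = V - {w}" by auto
    then show "W \<in> (\<lambda>w. V - {w}) ` V" by blast
  qed (auto simp: Diff_Diff_Int)
  have inj: "inj_on (\<lambda>w. V - {w}) V" by (auto simp: inj_on_def)
  have "size {#e \<in># E. e \<subseteq> V - {w}#} = size E - vertex_degree E w" for w
  proof -
    have "{#e \<in># E. e \<subseteq> V - {w}#} = {#e \<in># E. w \<notin> e#}"
      using assms by (intro filter_mset_cong) (auto simp: multigraph_def)
    moreover have "size E = vertex_degree E w + size {#e \<in># E. w \<notin> e#}"
      unfolding vertex_degree_def by (metis multiset_partition size_union)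
    ultimately show ?thesis by simp
  qed
  then show ?thesis
    unfolding coeff_trichrom_v1[OF assms] sets by (simp add: sum.reindex[OF inj])
qed

lemma inner_degree_trichrom_v1:
  assumes "multigraph V E"
  shows "inner_degree (trichrom_v1 V E) = size E"
proof -
  have le: "degree (coeff (trichrom_v1 V E) k) \<le> size E" for k
    unfolding coeff_trichrom_v1[OF assms]
  proof (rule degree_sum_le)
    show "finite {W. W \<subseteq> V \<and> card (V - W) = k}"
      using assms by (simp add: multigraph_def)
    show "degree (monom (1::int) (size {#e \<in># E. e \<subseteq> W#})) \<le> size E" for W
      by (simp add: degree_monom_eq size_filter_mset_lesseq)
  qed
  have "degree (coeff (trichrom_v1 V E) 0) = size E"
    by (simp add: coeff_trichrom_v1_0[OF assms] degree_monom_eq)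
  then show ?thesis
    unfolding inner_degree_def using le
    by (intro Max_eqI) (auto intro: finite_subset[of _ "{..size E}"] rangeI dest: sym)
qed

theorem theorem11:
  fixes V :: "'a set" and E :: "'a set multiset"
  assumes "multigraph V E"
  shows "(\<forall>i \<in> {0..size E}.
            int (num_vertices_of_degree V E i) = coeff (coeff (trichrom_v1 V E) 1) (size E - i))
         \<and> size E = inner_degree (trichrom_v1 V E)"
proof (intro conjI ballI)
  fix i assume i: "i \<in> {0..size E}"
  have fin: "finite V" using assms by (simp add: multigraph_def)
  have "vertex_degree E w \<le> size E" for w
    unfolding vertex_degree_def by (rule size_filter_mset_lesseq)
  \<comment> \<open>Both \<open>i\<close> and the vertex degrees are at most \<open>size E\<close>, so truncated subtraction loses nothing.\<close>
  then have "size E - vertex_degree E w = size E - i \<longleftrightarrow> vertex_degree E w = i" for w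
    using i by (metis atLeastAtMost_iff diff_diff_cancel)
  then show "int (num_vertices_of_degree V E i) = coeff (coeff (trichrom_v1 V E) 1) (size E - i)"
    using fin by (simp add: coeff_trichrom_v1_1[OF assms] coeff_sum sum.If_cases Int_def
        num_vertices_of_degree_def del: One_nat_def)
qed (simp add: inner_degree_trichrom_v1[OF assms])

end
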